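(* Let $(a_i)_{i\geq 1}$ be a sequence of non-negative integers, and let $(S_n)_{n\in\mathbb{Z}}$ be the sequence defined by $S_0=1$, $S_n=0$ for $n<0$, and $$S_n=\sum_{i=1}^{n}a_i S_{n-i}\qquad\text{for } n\geq 1.$$ Let $\mathcal{T}=\{i\geq 1 : a_i>0\}$. Then for all integers $n,k\geq 1$, $$S_{n+k}=S_nS_k+\sum_{\substack{i\in\mathcal{T}\\ i\neq 1}}a_i\sum_{j=1}^{i-1}S_{n-j}S_{k-i+j}.$$
   Context: Since $S_r=0$ for $r<0$, the inner terms vanish whenever $i>n+k$, so the sum over $i\in\mathcal{T}$ has only finitely many nonzero terms even if $\mathcal{T}$ is infinite. (Combinatorially, $S_n$ is the number of tilings of a $1\times n$ board by tiles $1\times i$, where each tile of length $i$ can be coloured in $a_i$ colours.) *)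

theory Defs
  imports "HOL-Analysis.Infinite_Sum"
begin

text \<open>
  The coefficient sequence is a function on \<^typ>\<open>nat\<close> of which only the values at indices
  \<open>i \<ge> 1\<close> are used; the value at \<open>0\<close> is irrelevant.
\<close>

function tiling_seq :: "(nat \<Rightarrow> nat) \<Rightarrow> int \<Rightarrow> nat" where
  "tiling_seq a n =
     (if n < 0 then 0
      else if n = 0 then 1
      else (\<Sum>i = 1..nat n. a i * tiling_seq a (n - int i)))"
  by pat_completeness auto
termination
  by (relation "measure (\<lambda>(a, n). nat n)") auto

declare tiling_seq.simps [simp del]

lemma tiling_seq_neg: "n < 0 \<Longrightarrow> tiling_seq a n = 0"
  by (simp add: tiling_seq.simps)

lemma tiling_seq_0: "tiling_seq a 0 = 1"
  by (simp add: tiling_seq.simps)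

lemma tiling_seq_rec:
  "n \<ge> 1 \<Longrightarrow> tiling_seq a n = (\<Sum>i = 1..nat n. a i * tiling_seq a (n - int i))"
  by (subst tiling_seq.simps) simp

definition tile_lengths :: "(nat \<Rightarrow> nat) \<Rightarrow> nat set" where
  "tile_lengths a = {i. i \<ge> 1 \<and> a i > 0}"

end

theory Submission
  imports Defs
begin

text \<open>
  Cut a board of length \<open>n + k\<close> after cell \<open>n\<close>. Either the cut falls between two tiles, which
  gives the product \<open>S\<^sub>n S\<^sub>k\<close>, or it passes through the interior of a tile of some length \<open>i\<close>,
  \<open>j\<close> of whose cells lie to the left of the cut (\<open>1 \<le> j \<le> i - 1\<close>), which leaves boards of
  lengths \<open>n - j\<close> and \<open>k - i + j\<close> to be tiled. The right-hand side of the identity is therefore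
  the number of tilings, classified by what happens at the cut.

  Algebraically, the classified count does not change when the cut moves by one cell. For each tile
  length \<open>i\<close>, moving the cut only exchanges the two extreme positions of the tile, in which the tile
  ends or begins at one of the two cuts (\<open>straddle_shift\<close>). Summed over \<open>i\<close> with weights \<open>a\<^sub>i\<close>,
  these extreme terms are, by the recurrence, exactly the products \<open>S\<^sub>n S\<^sub>k\<close> and
  \<open>S\<^bsub>n-1\<^esub> S\<^bsub>k+1\<^esub>\<close>. So the cut can be moved to position \<open>0\<close>, where no tile straddles it and the count is
  \<open>S\<^sub>0 S\<^bsub>n+k\<^esub>\<close>.
\<close>

definition straddle :: "(nat \<Rightarrow> nat) \<Rightarrow> int \<Rightarrow> int \<Rightarrow> nat \<Rightarrow> nat" where
  "straddle a n k i =
     (\<Sum>j = 1..i - 1. tiling_seq a (n - int j) * tiling_seq a (k - int i + int j))"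

text \<open>A tile longer than the board cannot be placed: the two remaining lengths have negative sum.\<close>

lemma straddle_eq_0:
  assumes "n + k < int i"
  shows "straddle a n k i = 0"
  unfolding straddle_def
proof (rule sum.neutral, rule ballI)
  fix j
  have "n - int j < 0 \<or> k - int i + int j < 0"
    using assms by linarith
  then show "tiling_seq a (n - int j) * tiling_seq a (k - int i + int j) = 0"
    by (auto simp: tiling_seq_neg)
qed

text \<open>
  A common upper limit for all the sums over tile lengths makes it possible to combine them
  termwise; the added terms vanish because \<open>S\<close> does at negative arguments.
\<close>

lemma tiling_seq_rec_upto:
  assumes "n \<ge> 1" and "n \<le> int N"
  shows "tiling_seq a n = (\<Sum>i = 1..N. a i * tiling_seq a (n - int i))"
proof -
  have "(\<Sum>i = 1..nat n. a i * tiling_seq a (n - int i)) =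
        (\<Sum>i = 1..N. a i * tiling_seq a (n - int i))"
    using assms by (intro sum.mono_neutral_left) (auto simp: tiling_seq_neg)
  then show ?thesis
    using assms(1) by (simp add: tiling_seq_rec)
qed

text \<open>
  Both sides count the ways to place a tile of length \<open>i\<close> so that it covers cell \<open>n\<close> and to tile
  what remains on either side. Such a tile straddles the cut before cell \<open>n\<close> or begins there (left),
  and it straddles the cut after cell \<open>n\<close> or ends there (right).
\<close>

lemma straddle_shift:
  assumes "i \<ge> 1"
  shows "straddle a (n - 1) (k + 1) i + tiling_seq a (n - 1) * tiling_seq a (k + 1 - int i) =
         straddle a n k i + tiling_seq a (n - int i) * tiling_seq a k"
proof -
  define g where "g j = tiling_seq a (n - int j) * tiling_seq a (k - int i + int j)" for j
  obtain m where i: "i = Suc m"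
    using assms by (cases i) auto
  have "straddle a (n - 1) (k + 1) i = (\<Sum>j = 1..m. g (Suc j))"
    unfolding straddle_def g_def i by (intro sum.cong) (auto simp: algebra_simps)
  also have "\<dots> = (\<Sum>j = Suc 1..Suc m. g j)"
    by (rule sum.shift_bounds_cl_Suc_ivl [symmetric])
  finally have "straddle a (n - 1) (k + 1) i + g 1 = (\<Sum>j = 1..Suc m. g j)"
    using sum.atLeast_Suc_atMost [of 1 "Suc m" g] by (simp del: sum.cl_ivl_Suc)
  also have "\<dots> = straddle a n k i + g i"
    unfolding straddle_def g_def i by simp
  finally show ?thesis
    by (simp add: g_def algebra_simps)
qed

lemma tiling_seq_add_upto:
  assumes "k \<ge> 0" and "int m + k \<le> int N"
  shows "tiling_seq a (int m) * tiling_seq a k + (\<Sum>i = 1..N. a i * straddle a (int m) k i) =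
         tiling_seq a (int m + k)"
  using assms
proof (induction m arbitrary: k)
  case 0
  have "straddle a 0 k i = 0" for i
    unfolding straddle_def by (intro sum.neutral) (auto simp: tiling_seq_neg)
  then show ?case
    by (simp add: tiling_seq_0)
next
  case (Suc m)
  define n where "n = int (Suc m)"
  have m: "int m = n - 1"
    by (simp add: n_def)
  have rec_n: "tiling_seq a n = (\<Sum>i = 1..N. a i * tiling_seq a (n - int i))"
    using Suc.prems by (intro tiling_seq_rec_upto) (auto simp: n_def)
  have rec_k: "tiling_seq a (k + 1) = (\<Sum>i = 1..N. a i * tiling_seq a (k + 1 - int i))"
    using Suc.prems by (intro tiling_seq_rec_upto) auto
  have "tiling_seq a n * tiling_seq a k + (\<Sum>i = 1..N. a i * straddle a n k i) =
        (\<Sum>i = 1..N. a i * (straddle a n k i + tiling_seq a (n - int i) * tiling_seq a k))"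
    by (subst rec_n) (simp add: sum_distrib_right sum.distrib distrib_left mult.assoc)
  also have "\<dots> = (\<Sum>i = 1..N. a i * (straddle a (n - 1) (k + 1) i +
                               tiling_seq a (n - 1) * tiling_seq a (k + 1 - int i)))"
    by (intro sum.cong refl) (simp add: straddle_shift)
  also have "\<dots> = tiling_seq a (n - 1) * tiling_seq a (k + 1) +
                  (\<Sum>i = 1..N. a i * straddle a (n - 1) (k + 1) i)"
    by (subst rec_k) (simp add: sum_distrib_left sum.distrib distrib_left mult.left_commute)
  also have "\<dots> = tiling_seq a (n + k)"
    using Suc.IH [of "k + 1"] Suc.prems by (simp add: m)
  finally show ?case
    by (simp add: n_def)
qed

theorem theorem3:
  fixes a :: "nat \<Rightarrow> nat" and n k :: int
  assumes "n \<ge> 1" and "k \<ge> 1"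
  shows "finite {i \<in> tile_lengths a - {1}.
           a i * (\<Sum>j = 1..i - 1. tiling_seq a (n - int j) * tiling_seq a (k - int i + int j)) \<noteq> 0} \<and>
         tiling_seq a (n + k) =
           tiling_seq a n * tiling_seq a k +
           (\<Sum>\<^sub>\<infinity>i\<in>tile_lengths a - {1}.
             a i * (\<Sum>j = 1..i - 1. tiling_seq a (n - int j) * tiling_seq a (k - int i + int j)))"
proof -
  let ?f = "\<lambda>i. a i * straddle a n k i"
  let ?T = "tile_lengths a - {1}"
  define N where "N = nat (n + k)"
  have N: "int N = n + k"
    using assms by (simp add: N_def)
  have bound: "i \<le> N" if "?f i \<noteq> 0" for i
    using that straddle_eq_0 [of n k i a] N by (cases "i \<le> N") auto
  have fin: "finite {i \<in> ?T. ?f i \<noteq> 0}"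
  proof (rule finite_subset)
    show "{i \<in> ?T. ?f i \<noteq> 0} \<subseteq> {..N}"
      using bound by blast
  qed simp
  \<comment> \<open>Lengths outside \<open>?T\<close> contribute nothing: either \<open>a i = 0\<close>, or \<open>i = 1\<close>, and a tile of
    length \<open>1\<close> has no interior for the cut to pass through.\<close>
  have "infsum ?f ?T = infsum ?f {1..N}"
  proof (rule infsum_cong_neutral)
    show "?f i = 0" if "i \<in> {1..N} - ?T" for i
      using that by (auto simp: tile_lengths_def straddle_def)
    show "?f i = 0" if "i \<in> ?T - {1..N}" for i
      using that bound [of i] by (auto simp: tile_lengths_def)
  qed simp
  also have "\<dots> = (\<Sum>i = 1..N. ?f i)"
    by simp
  finally have "tiling_seq a (n + k) = tiling_seq a n * tiling_seq a k + infsum ?f ?T"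
    using tiling_seq_add_upto [of k "nat n" N a] assms N by simp
  with fin show ?thesis
    unfolding straddle_def by blast
qed

end
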